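(* For every integer $n\ge1$, the map $\Phi_{\mathrm B}:\mathcal{PT}_{\mathrm B}(n)\to B_n$ is a bijection.
   Context: Shifted Ferrers diagrams: a Ferrers diagram $F$ of length $n$ (rows plus columns, empty rows and columns allowed) has its south-east border steps labeled $1,\dots,n$ from north-east to south-west; a row gets the label of its south step, a column the label of its west step. So $F$ amounts to a splitting of $\{1,\dots,n\}$ into row labels and column labels; rows go top to bottom in increasing label order, columns left to right in decreasing label order, and there is a cell in Row $r$, Column $c$ iff $r<c$. If $F$ has $k$ columns, the shifted Ferrers diagram $\overline F$ is obtained by adding $k$ left-justified rows of sizes $1,2,\dots,k$ (top to bottom) above $F$; its length is that of $F$. The rightmost cells of the added rows are the diagonal cells. The added row whose diagonal cell is in Column $j$ is labeled $-j$; thus Row $-j$ has a cell in Column $c$ iff $c\ge j$ ($c$ a column label), and rows are again ordered top to bottom by increasing label. Type B permutation tableaux: $\mathcal{PT}_{\mathrm B}(n)$ is the set of shifted Ferrers diagrams of length $n$ with a $0,1$-filling such that (1) each column has at least one $1$; (2) there is no $0$ having both a $1$ above it in the same column and a $1$ to the left of it in the same row; (3) if a diagonal cell contains $0$, there is no $1$ to the left of it in the same row. A $0$ is restricted if it has a $1$ above it in the same column or it is in a diagonal cell. A row is unrestricted if it contains no restricted $0$. Alternative representation of $T\in\mathcal{PT}_{\mathrm B}(n)$: replace each topmost $1$ (topmost $1$ of its column) by $\uparrow$ and each rightmost restricted $0$ (rightmost restricted $0$ of its row) by $\leftarrow$, erase all other entries, and then discard the diagonal cells together with any arrows in them. So arrows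 remain only in non-diagonal cells, each column has at most one $\uparrow$, and Column $c$ has no $\uparrow$ exactly when the diagonal cell of Column $c$ contains a $1$. $B_n$ is the set of type B permutations of $\{1,\dots,n\}$: words obtained from a permutation of $\{1,\dots,n\}$ (in one-line notation) by negating any subset of its entries. The map $\Phi_{\mathrm B}$: let $T\in\mathcal{PT}_{\mathrm B}(n)$ (in alternative representation) have columns labeled $c_1<\cdots<c_k$. Let $\pi^{(k+1)}$ be the word of the labels of the unrestricted rows of $T$ in increasing order. For $i=k,k-1,\dots,1$, obtain $\pi^{(i)}$ from $\pi^{(i+1)}$ as follows. If Column $c_i$ has a $\uparrow$, in Row $r_0$ say, insert $c_i$ immediately before $r_0$; if Column $c_i$ has no $\uparrow$, do nothing (in this case $-c_i$ is already in the word). Then, if $r_1<\cdots<r_s$ are the labels of the rows containing a $\leftarrow$ in Column $c_i$, insert $r_1,\dots,r_s$ in this order immediately before $c_i$ (if Column $c_i$ has a $\uparrow$) or immediately before $-c_i$ (if not). Set $\Phi_{\mathrm B}(T)=\pi^{(1)}$. *)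

theory Defs
  imports "HOL-Combinatorics.Multiset_Permutations"
begin

text \<open>
  A Ferrers diagram of length \<open>n\<close> is given by the set \<open>C\<close> of its column labels, a subset of
  \<open>{1..n}\<close>; the remaining labels are those of its rows. Its shifted diagram has the
  additional rows \<open>- c\<close> for \<open>c\<close> in \<open>C\<close>. Rows are ordered top to bottom by increasing label and
  columns left to right by decreasing label, so a cell \<open>(r', c)\<close> is above \<open>(r, c)\<close> iff \<open>r' < r\<close>,
  and \<open>(r, c')\<close> is to the left of \<open>(r, c)\<close> iff \<open>c < c'\<close>. The diagonal cell of Column \<open>c\<close>
  is \<open>(- c, c)\<close>.
\<close>

definition row_labels :: "nat \<Rightarrow> int set \<Rightarrow> int set" where
  "row_labels n C = ({1..int n} - C) \<union> uminus ` C"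

definition cells :: "nat \<Rightarrow> int set \<Rightarrow> (int \<times> int) set" where
  "cells n C = {(r, c). r \<in> row_labels n C \<and> c \<in> C \<and> (if r < 0 then - r \<le> c else r < c)}"

text \<open>A 0,1-filling is represented by the set of cells that contain a 1.\<close>

datatype filled_diagram = Filled_Diagram (cols: "int set") (ones: "(int \<times> int) set")

definition zeros :: "nat \<Rightarrow> filled_diagram \<Rightarrow> (int \<times> int) set" where
  "zeros n T = cells n (cols T) - ones T"

definition one_above :: "filled_diagram \<Rightarrow> int \<Rightarrow> int \<Rightarrow> bool" where
  "one_above T r c \<longleftrightarrow> (\<exists>r'<r. (r', c) \<in> ones T)"

definition one_left :: "filled_diagram \<Rightarrow> int \<Rightarrow> int \<Rightarrow> bool" where
  "one_left T r c \<longleftrightarrow> (\<exists>c'>c. (r, c') \<in> ones T)"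

definition PT_B :: "nat \<Rightarrow> filled_diagram set" where
  "PT_B n = {T. cols T \<subseteq> {1..int n} \<and> ones T \<subseteq> cells n (cols T) \<and>
     (\<forall>c\<in>cols T. \<exists>r. (r, c) \<in> ones T) \<and>
     (\<forall>(r, c)\<in>zeros n T. \<not> (one_above T r c \<and> one_left T r c)) \<and>
     (\<forall>c\<in>cols T. (- c, c) \<in> zeros n T \<longrightarrow> \<not> one_left T (- c) c)}"

definition restricted_zeros :: "nat \<Rightarrow> filled_diagram \<Rightarrow> (int \<times> int) set" where
  "restricted_zeros n T = {(r, c)\<in>zeros n T. one_above T r c \<or> r = - c}"

definition unrestricted_rows :: "nat \<Rightarrow> filled_diagram \<Rightarrow> int set" where
  "unrestricted_rows n T = {r \<in> row_labels n (cols T). \<forall>c. (r, c) \<notin> restricted_zeros n T}"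

text \<open>
  The arrows of the alternative representation. Arrows in diagonal cells are discarded only
  after the topmost 1s and the rightmost restricted 0s have been determined.
\<close>

definition up_arrows :: "filled_diagram \<Rightarrow> (int \<times> int) set" where
  "up_arrows T = {(r, c)\<in>ones T. \<not> one_above T r c \<and> r \<noteq> - c}"

definition left_arrows :: "nat \<Rightarrow> filled_diagram \<Rightarrow> (int \<times> int) set" where
  "left_arrows n T =
     {(r, c)\<in>restricted_zeros n T. (\<forall>c'<c. (r, c') \<notin> restricted_zeros n T) \<and> r \<noteq> - c}"

text \<open>
  Inserting \<open>us\<close> immediately before the letter \<open>x\<close> of the word \<open>w\<close>. If \<open>x\<close> does not occur in
  \<open>w\<close>, the insertion is undefined; this is recorded by the empty word, which all further
  insertions preserve. The empty word is not a type B permutation for \<open>n \<ge> 1\<close>, so a failed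
  insertion cannot be mistaken for a proper value of the map.
\<close>

definition insert_before :: "'a list \<Rightarrow> 'a \<Rightarrow> 'a list \<Rightarrow> 'a list" where
  "insert_before us x w =
     (if x \<in> set w then takeWhile (\<lambda>y. y \<noteq> x) w @ us @ dropWhile (\<lambda>y. y \<noteq> x) w else [])"

definition process_column :: "nat \<Rightarrow> filled_diagram \<Rightarrow> int \<Rightarrow> int list \<Rightarrow> int list" where
  "process_column n T c w =
     (let rs = sorted_list_of_set {r. (r, c) \<in> left_arrows n T}
      in if \<exists>r. (r, c) \<in> up_arrows T
         then insert_before rs c (insert_before [c] (THE r. (r, c) \<in> up_arrows T) w)
         else insert_before rs (- c) w)"

text \<open>The use of \<^term>\<open>foldr\<close> makes the largest column label come first.\<close>

definition Phi_B :: "nat \<Rightarrow> filled_diagram \<Rightarrow> int list" where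
  "Phi_B n T = foldr (process_column n T) (sorted_list_of_set (cols T))
     (sorted_list_of_set (unrestricted_rows n T))"

definition type_B_perms :: "nat \<Rightarrow> int list set" where
  "type_B_perms n = {map (\<lambda>x. if x \<in> S then - x else x) p | p S.
     p \<in> permutations_of_set {1..int n} \<and> S \<subseteq> {1..int n}}"

end

theory Submission
  imports Defs
begin

text \<open>
  A tableau is encoded by the row \<open>U c\<close> of the topmost 1 of every column and the column \<open>M r\<close> of
  the rightmost restricted 0 of every row (\<open>n + 1\<close> if there is none), diagonal cells included:
  its 1s are exactly the cells \<open>(r, c)\<close> with \<open>U c \<le> r\<close> and \<open>c < M r\<close>.
  Counting the topmost 1 in a diagonal cell as an arrow, processing a column \<open>c\<close> always inserts
  \<open>r\<^sub>1, \<dots>, r\<^sub>s\<close> and possibly \<open>c\<close> immediately before \<open>U c\<close>, where \<open>U c < r\<^sub>i < c\<close>.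
  In the words that arise after processing a set \<open>D\<close> of largest columns, a letter of \<open>D\<close> is followed
  by one of smaller modulus, and any other letter \<open>x\<close> by some \<open>y > x\<close> or by some \<open>- d\<close> with
  \<open>x < d \<in> D\<close>. This makes the last insertion reversible: the inserted rows form the maximal run of
  letters strictly between \<open>U c\<close> and \<open>c\<close> that precedes \<open>c\<close> (or \<open>- c\<close>). When \<open>D\<close> consists
  of all columns, the column labels can be read off: a positive letter is a column label iff it is
  followed by a letter of smaller modulus.
\<close>

section \<open>Words\<close>

definition follows :: "int set \<Rightarrow> int \<Rightarrow> int \<Rightarrow> bool" where
  "follows D x y \<longleftrightarrow> (if x \<in> D then - x < y \<and> y < x else x < y \<or> - y \<in> D \<and> x < - y)"

text \<open>For a column outside \<open>D\<close>, \<open>- c\<close> is an ordinary row letter that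
  may be present or absent. Keeping the last letter out of \<open>D\<close> ensures that every
  letter of \<open>D\<close> in the word has a successor, which \<open>follows\<close> then
  bounds.\<close>

definition stage_word :: "nat \<Rightarrow> int set \<Rightarrow> int set \<Rightarrow> int list \<Rightarrow> bool" where
  "stage_word n C D w \<longleftrightarrow> distinct w \<and> set w \<subseteq> D \<union> row_labels n C \<and>
     (\<forall>c\<in>D. c \<in> set w \<longleftrightarrow> - c \<notin> set w) \<and>
     successively (follows D) w \<and> (w \<noteq> [] \<longrightarrow> last w \<notin> D)"

text \<open>The value \<open>r\<^sub>0 = - c\<close> encodes a topmost 1 in the diagonal cell: no up
  arrow remains, so only the rows are inserted.\<close>

definition insert_column :: "int \<Rightarrow> int \<Rightarrow> int set \<Rightarrow> int list \<Rightarrow> int list" where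
  "insert_column c r\<^sub>0 A =
     insert_before (sorted_list_of_set A @ (if r\<^sub>0 = - c then [] else [c])) r\<^sub>0"

text \<open>The bounds on \<open>A\<close> reflect that a non-diagonal restricted 0 lies below the
  topmost 1 of its column. The last clause reflects that otherwise the diagonal 0 is the rightmost
  restricted 0 of Row \<open>- c\<close>, so that this row never enters the word.\<close>

definition insertable :: "nat \<Rightarrow> int set \<Rightarrow> int \<Rightarrow> int \<Rightarrow> int set \<Rightarrow> int list \<Rightarrow> bool" where
  "insertable n C c r\<^sub>0 A w \<longleftrightarrow> r\<^sub>0 \<in> set w \<and> r\<^sub>0 \<in> row_labels n C \<and> - c \<le> r\<^sub>0 \<and> r\<^sub>0 < c \<and>
     A \<subseteq> row_labels n C \<and> (\<forall>r\<in>A. r\<^sub>0 < r \<and> r < c) \<and> A \<inter> set w = {} \<and>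
     (r\<^sub>0 \<noteq> - c \<longrightarrow> - c \<notin> set w)"

lemma insert_before_split:
  assumes "x \<notin> set u"
  shows "insert_before us x (u @ x # v) = u @ us @ x # v"
  using assms by (auto simp: insert_before_def takeWhile_append dropWhile_append)

text \<open>Serves to cut an inserted block off a prefix, with \<open>P\<close> expressing that a
  letter lies strictly between \<open>r\<^sub>0\<close> and \<open>c\<close>.\<close>

lemma takeWhile_rev_append:
  assumes "\<forall>x\<in>set ys. P x" and "xs = [] \<or> \<not> P (last xs)"
  shows "rev (takeWhile P (rev (xs @ ys))) = ys"
  using assms by (cases xs rule: rev_cases) (auto simp: takeWhile_append takeWhile_eq_all_conv[THEN iffD2])

lemma successively_iff_split:
  "successively P w \<longleftrightarrow> (\<forall>u x y v. w = u @ x # y # v \<longrightarrow> P x y)"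
proof
  assume "successively P w"
  then show "\<forall>u x y v. w = u @ x # y # v \<longrightarrow> P x y" by (auto simp: successively_append_iff)
next
  assume *: "\<forall>u x y v. w = u @ x # y # v \<longrightarrow> P x y"
  have "w = take i w @ w ! i # w ! Suc i # drop (Suc (Suc i)) w" if "Suc i < length w" for i
    using that by (metis Cons_nth_drop_Suc Suc_lessD append_take_drop_id)
  with * show "successively P w" unfolding successively_conv_nth by blast
qed

text \<open>Merges the two insertions of \<open>process_column\<close> into the single one of
  \<open>insert_column\<close>.\<close>

lemma insert_before_append:
  assumes "c \<notin> set w" and "c \<noteq> r"
  shows "insert_before us c (insert_before [c] r w) = insert_before (us @ [c]) r w"
proof (cases "r \<in> set w")
  case True
  then obtain u v where w: "w = u @ r # v" "r \<notin> set u" by (meson split_list_first)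
  then have "insert_before us c (insert_before [c] r w) = insert_before us c (u @ c # r # v)"
    by (simp add: insert_before_split)
  also have "\<dots> = u @ us @ c # r # v"
    using assms w by (intro insert_before_split) auto
  finally show ?thesis using w by (simp add: insert_before_split)
qed (simp add: insert_before_def)

section \<open>Labels of a diagram, and the reversibility of inserting one column\<close>

locale column_labels =
  fixes n :: nat and C :: "int set"
  assumes cols_bounded: "C \<subseteq> {1..int n}"
begin

lemma finite_cols [simp]: "finite C"
  using cols_bounded finite_subset by blast

lemma finite_rows [simp]: "finite (row_labels n C)"
  by (simp add: row_labels_def)

lemma col_bounds: "c \<in> C \<Longrightarrow> 1 \<le> c \<and> c \<le> int n"
  using cols_bounded by auto

lemma col_not_row: "c \<in> C \<Longrightarrow> c \<notin> row_labels n C"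
  using col_bounds[of c] col_bounds[of "- c"] by (auto simp: row_labels_def)

lemma uminus_col_row: "c \<in> C \<Longrightarrow> - c \<in> row_labels n C"
  by (auto simp: row_labels_def)

lemma row_bounds: "r \<in> row_labels n C \<Longrightarrow> - int n \<le> r \<and> r \<le> int n \<and> r \<noteq> 0"
  using col_bounds[of r] col_bounds[of "- r"] by (auto simp: row_labels_def)

lemma row_negD: "r \<in> row_labels n C \<Longrightarrow> r < 0 \<Longrightarrow> - r \<in> C"
  by (auto simp: row_labels_def)

text \<open>Negative rows satisfy \<open>r < c\<close> and positive rows \<open>- c \<le> r\<close>
  automatically, so both kinds obey the same inequalities.\<close>

lemma cells_iff:
  "(r, c) \<in> cells n C \<longleftrightarrow> r \<in> row_labels n C \<and> c \<in> C \<and> - c \<le> r \<and> r < c"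
  using col_bounds[of c] by (auto simp: cells_def)

text \<open>The last conclusion makes the inserted block detectable. A letter of \<open>D\<close>
  before \<open>r\<^sub>0\<close> exceeds \<open>c\<close>; any other one is smaller than
  \<open>r\<^sub>0\<close>, since \<open>- r\<^sub>0 \<le> c\<close> keeps
  \<open>- r\<^sub>0\<close> out of \<open>D\<close>.\<close>

lemma insert_column_split:
  assumes sw: "stage_word n C D w" and ins: "insertable n C c r\<^sub>0 A w"
    and c: "c \<in> C" and D: "D \<subseteq> C" "\<forall>d\<in>D. c < d"
  obtains u v where "w = u @ r\<^sub>0 # v" "r\<^sub>0 \<notin> set u"
    "insert_column c r\<^sub>0 A w =
       u @ sorted_list_of_set A @ (if r\<^sub>0 = - c then [] else [c]) @ r\<^sub>0 # v"
    "u = [] \<or> follows D (last u) r\<^sub>0 \<and> \<not> (r\<^sub>0 < last u \<and> last u < c)"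
proof -
  have "r\<^sub>0 \<in> set w" using ins by (simp add: insertable_def)
  then obtain u v where w: "w = u @ r\<^sub>0 # v" "r\<^sub>0 \<notin> set u" by (meson split_list_first)
  have "follows D (last u) r\<^sub>0" if "u \<noteq> []"
    using sw w that by (auto simp: stage_word_def successively_append_iff)
  moreover have "\<not> (r\<^sub>0 < x \<and> x < c)" if "follows D x r\<^sub>0" for x
  proof (cases "x \<in> D")
    case False
    have "- r\<^sub>0 \<notin> D" using D ins unfolding insertable_def by force
    then show ?thesis using that False by (auto simp: follows_def)
  qed (use D in auto)
  ultimately show thesis
    using w by (intro that[of u v]) (auto simp: insert_column_def insert_before_split)
qed

lemma stage_word_insert_column:
  assumes sw: "stage_word n C D w" and ins: "insertable n C c r\<^sub>0 A w"
    and c: "c \<in> C" and D: "D \<subseteq> C" "\<forall>d\<in>D. c < d"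
  shows "stage_word n C (insert c D) (insert_column c r\<^sub>0 A w)"
    and "set (insert_column c r\<^sub>0 A w) = set w \<union> A \<union> (if r\<^sub>0 = - c then {} else {c})"
proof -
  obtain u v where w: "w = u @ r\<^sub>0 # v" "r\<^sub>0 \<notin> set u"
    and eq: "insert_column c r\<^sub>0 A w =
       u @ sorted_list_of_set A @ (if r\<^sub>0 = - c then [] else [c]) @ r\<^sub>0 # v"
    and u: "u = [] \<or> follows D (last u) r\<^sub>0 \<and> \<not> (r\<^sub>0 < last u \<and> last u < c)"
    using insert_column_split[OF assms] by metis
  have ins': "r\<^sub>0 \<in> set w" "r\<^sub>0 \<in> row_labels n C" "- c \<le> r\<^sub>0" "r\<^sub>0 < c" "A \<subseteq> row_labels n C"
    "\<forall>r\<in>A. r\<^sub>0 < r \<and> r < c" "A \<inter> set w = {}" "r\<^sub>0 \<noteq> - c \<Longrightarrow> - c \<notin> set w"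
    using ins by (auto simp: insertable_def)
  have finA: "finite A" using ins'(5) finite_rows by (rule finite_subset)
  show set_eq: "set (insert_column c r\<^sub>0 A w) = set w \<union> A \<union> (if r\<^sub>0 = - c then {} else {c})"
    unfolding eq unfolding w(1) using finA by auto
  have cw: "c \<notin> set w"
    using sw c D col_not_row by (auto simp: stage_word_def)
  have cpos: "0 < c" using col_bounds[OF c] by simp
  have cA: "c \<notin> A" "- c \<notin> A" using ins' by force+
  let ?w = "insert_column c r\<^sub>0 A w"
  have sw': "distinct w" "set w \<subseteq> D \<union> row_labels n C" "\<forall>d\<in>D. d \<in> set w \<longleftrightarrow> - d \<notin> set w"
     "successively (follows D) w" "w \<noteq> [] \<longrightarrow> last w \<notin> D"
    using sw by (auto simp: stage_word_def)
  have "distinct ?w"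
    using sw' cw cA ins'(7) finA w unfolding eq by auto
  moreover have "set ?w \<subseteq> insert c D \<union> row_labels n C"
    unfolding set_eq using sw' ins' by auto
  moreover have "\<forall>d\<in>insert c D. d \<in> set ?w \<longleftrightarrow> - d \<notin> set ?w"
  proof
    fix d assume d: "d \<in> insert c D"
    show "d \<in> set ?w \<longleftrightarrow> - d \<notin> set ?w"
    proof (cases "d = c")
      case True
      then show ?thesis unfolding set_eq using ins' cA cw cpos by auto
    next
      case False
      then have "d \<in> D" "c < d" using d D by auto
      then have "d \<notin> A" "- d \<notin> A" "- d \<noteq> c" using ins' cpos by force+
      then show ?thesis unfolding set_eq using sw' \<open>d \<in> D\<close> False by auto
    qed
  qed
  moreover have "successively (follows (insert c D)) ?w"
  proof -
    let ?F = "follows (insert c D)"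
    \<comment> \<open>Adding \<open>c\<close> to \<open>D\<close> restricts \<open>follows\<close>
      only for the first letter \<open>c\<close>, which is absent from \<open>w\<close>.\<close>
    have "successively ?F w"
      using sw'(4) by (rule successively_mono) (use cw in \<open>auto simp: follows_def\<close>)
    then have 1: "successively ?F u" "successively ?F (r\<^sub>0 # v)"
      by (auto simp: w successively_append_iff)
    have low: "?F x y" if "x \<in> A" "x < y" for x y
      using that ins' D by (force simp: follows_def)
    have "successively (<) (sorted_list_of_set A)"
      by (intro successively_if_sorted_wrt) simp
    then have 2: "successively ?F (sorted_list_of_set A)"
      by (rule successively_mono) (use low finA in auto)
    have lastA: "last (sorted_list_of_set A) \<in> A" "hd (sorted_list_of_set A) \<in> A" if "A \<noteq> {}"
      using finA that last_in_set[of "sorted_list_of_set A"] hd_in_set[of "sorted_list_of_set A"]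
      by auto
    \<comment> \<open>The pair \<open>x\<close>, \<open>- c\<close> becomes admissible only because
      \<open>c\<close> has joined \<open>D\<close>.\<close>
    have 3: "?F x c" "?F x (- c)" if "x \<in> A" for x
      using low[OF that, of c] that ins' cA D by (auto simp: follows_def)
    have 4: "?F c r\<^sub>0" if "r\<^sub>0 \<noteq> - c" using that ins' by (auto simp: follows_def)
    \<comment> \<open>The letter before the block is in \<open>D\<close>, hence larger than
      \<open>c\<close>, or it is below \<open>r\<^sub>0\<close>. Either way every possible first
      letter of the block may follow it.\<close>
    have 5: "?F (last u) y" if "u \<noteq> []" "r\<^sub>0 \<le> y" "y \<le> c" for y
    proof -
      have f: "follows D (last u) r\<^sub>0" using u that by auto
      have "last u \<noteq> c" using cw that w by auto
      moreover have "- r\<^sub>0 \<notin> D" using D ins' by force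
      moreover have "c < last u" if "last u \<in> D" using that D by auto
      ultimately show ?thesis using f that ins' u by (auto simp: follows_def)
    qed
    have 6: "?F (last u) r\<^sub>0" "?F (last u) c" "A \<noteq> {} \<Longrightarrow> ?F (last u) (hd (sorted_list_of_set A))"
      if "u \<noteq> []"
      using 5[OF that] ins' lastA(2) by (simp_all add: less_imp_le)
    show ?thesis
    proof (cases "A = {}")
      case True
      then show ?thesis
        unfolding eq using 1 4 6 by (auto simp: successively_append_iff successively_Cons)
    next
      case False
      then have "sorted_list_of_set A \<noteq> []" using finA by simp
      then show ?thesis
        unfolding eq using 1 2 3[OF lastA(1)[OF False]] 4 6(3)[OF _ False]
        by (auto simp: successively_append_iff)
    qed
  qed
  moreover have "last ?w \<notin> insert c D"
  proof -
    have "last ?w = last w" unfolding eq unfolding w(1) by simp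
    moreover have "w \<noteq> []" by (simp add: w)
    ultimately show ?thesis using sw'(5) cw last_in_set[of w] by auto
  qed
  ultimately show "stage_word n C (insert c D) ?w" by (auto simp: stage_word_def)
qed

text \<open>The occurrence of \<open>c\<close> tells the two cases apart. Splitting at
  \<open>c\<close> or at \<open>- c\<close>, each of which occurs at most once, yields
  \<open>r\<^sub>0\<close> and the tail; a maximal run then separates the block from the rest of the
  prefix.\<close>

lemma insert_column_inject:
  assumes "stage_word n C D w\<^sub>1" "insertable n C c r\<^sub>1 A\<^sub>1 w\<^sub>1"
    and "stage_word n C D w\<^sub>2" "insertable n C c r\<^sub>2 A\<^sub>2 w\<^sub>2"
    and c: "c \<in> C" and D: "D \<subseteq> C" "\<forall>d\<in>D. c < d"
    and eq: "insert_column c r\<^sub>1 A\<^sub>1 w\<^sub>1 = insert_column c r\<^sub>2 A\<^sub>2 w\<^sub>2"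
  shows "r\<^sub>1 = r\<^sub>2 \<and> A\<^sub>1 = A\<^sub>2 \<and> w\<^sub>1 = w\<^sub>2"
proof -
  define s\<^sub>1 where "s\<^sub>1 = sorted_list_of_set A\<^sub>1"
  define s\<^sub>2 where "s\<^sub>2 = sorted_list_of_set A\<^sub>2"
  obtain u\<^sub>1 v\<^sub>1 where 1: "w\<^sub>1 = u\<^sub>1 @ r\<^sub>1 # v\<^sub>1"
    "insert_column c r\<^sub>1 A\<^sub>1 w\<^sub>1 = u\<^sub>1 @ s\<^sub>1 @ (if r\<^sub>1 = - c then [] else [c]) @ r\<^sub>1 # v\<^sub>1"
    "u\<^sub>1 = [] \<or> \<not> (r\<^sub>1 < last u\<^sub>1 \<and> last u\<^sub>1 < c)"
    using insert_column_split[OF assms(1,2) c D] unfolding s\<^sub>1_def by metis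
  obtain u\<^sub>2 v\<^sub>2 where 2: "w\<^sub>2 = u\<^sub>2 @ r\<^sub>2 # v\<^sub>2"
    "insert_column c r\<^sub>2 A\<^sub>2 w\<^sub>2 = u\<^sub>2 @ s\<^sub>2 @ (if r\<^sub>2 = - c then [] else [c]) @ r\<^sub>2 # v\<^sub>2"
    "u\<^sub>2 = [] \<or> \<not> (r\<^sub>2 < last u\<^sub>2 \<and> last u\<^sub>2 < c)"
    using insert_column_split[OF assms(3,4) c D] unfolding s\<^sub>2_def by metis
  have fin: "finite A\<^sub>1" "finite A\<^sub>2"
    using assms(2,4) finite_subset[OF _ finite_rows] unfolding insertable_def by blast+
  have cw: "c \<notin> set w\<^sub>1" "c \<notin> set w\<^sub>2"
    using assms(1,3) c D col_not_row by (auto simp: stage_word_def)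
  have A: "\<forall>r\<in>A\<^sub>1. r\<^sub>1 < r \<and> r < c" "\<forall>r\<in>A\<^sub>2. r\<^sub>2 < r \<and> r < c" "- c \<le> r\<^sub>1" "- c \<le> r\<^sub>2"
    using assms(2,4) by (auto simp: insertable_def)
  have cpos: "0 < c" using col_bounds[OF c] by simp
  note set_eq = stage_word_insert_column(2)[OF assms(1,2) c D]
    stage_word_insert_column(2)[OF assms(3,4) c D]
  have "c \<in> set (insert_column c r\<^sub>1 A\<^sub>1 w\<^sub>1) \<longleftrightarrow> r\<^sub>1 \<noteq> - c"
    "c \<in> set (insert_column c r\<^sub>2 A\<^sub>2 w\<^sub>2) \<longleftrightarrow> r\<^sub>2 \<noteq> - c"
    unfolding set_eq using cw A by auto
  then have iff: "r\<^sub>1 = - c \<longleftrightarrow> r\<^sub>2 = - c" using eq by simp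
  have "u\<^sub>1 @ s\<^sub>1 = u\<^sub>2 @ s\<^sub>2 \<and> r\<^sub>1 = r\<^sub>2 \<and> v\<^sub>1 = v\<^sub>2"
  proof (cases "r\<^sub>1 = - c")
    case True
    have d: "distinct w\<^sub>1" using assms(1) by (simp add: stage_word_def)
    have "- c \<notin> set (u\<^sub>1 @ s\<^sub>1)" "- c \<notin> set v\<^sub>1"
      using A True 1(1) d fin by (auto simp: s\<^sub>1_def)
    moreover have "(u\<^sub>1 @ s\<^sub>1) @ - c # v\<^sub>1 = (u\<^sub>2 @ s\<^sub>2) @ - c # v\<^sub>2"
      using eq 1(2) 2(2) True iff by simp
    ultimately have "u\<^sub>1 @ s\<^sub>1 = u\<^sub>2 @ s\<^sub>2 \<and> v\<^sub>1 = v\<^sub>2" using append_Cons_eq_iff by metis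
    then show ?thesis using True iff by simp
  next
    case False
    have "c \<notin> set (u\<^sub>1 @ s\<^sub>1)" "c \<notin> set (r\<^sub>1 # v\<^sub>1)"
      using A cw 1(1) fin by (auto simp: s\<^sub>1_def)
    moreover have "(u\<^sub>1 @ s\<^sub>1) @ c # r\<^sub>1 # v\<^sub>1 = (u\<^sub>2 @ s\<^sub>2) @ c # r\<^sub>2 # v\<^sub>2"
      using eq 1(2) 2(2) False iff by simp
    ultimately show ?thesis using append_Cons_eq_iff list.inject by metis
  qed
  \<comment> \<open>Both blocks are the maximal final run of the same prefix, for the same
    bounds.\<close>
  moreover from this have "s\<^sub>1 = s\<^sub>2"
    using takeWhile_rev_append[of s\<^sub>1 "\<lambda>x. r\<^sub>1 < x \<and> x < c" u\<^sub>1]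
      takeWhile_rev_append[of s\<^sub>2 "\<lambda>x. r\<^sub>1 < x \<and> x < c" u\<^sub>2] A 1(3) 2(3) fin
    by (auto simp: s\<^sub>1_def s\<^sub>2_def)
  ultimately show ?thesis
    using 1(1) 2(1) fin sorted_list_of_set_inject[of A\<^sub>1 A\<^sub>2] by (auto simp: s\<^sub>1_def s\<^sub>2_def)
qed

text \<open>Here \<open>r\<^sub>0\<close> is the successor of \<open>c\<close>, or
  \<open>- c\<close> if \<open>c\<close> is absent, and \<open>A\<close> is the maximal run before
  it. Deleting the block creates one new adjacency, in front of \<open>r\<^sub>0\<close>, which
  needs the maximality.\<close>

lemma insert_column_exhaust:
  assumes sw: "stage_word n C (insert c D) w"
    and c: "c \<in> C" and D: "D \<subseteq> C" "\<forall>d\<in>D. c < d"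
  obtains r\<^sub>0 A w' where "stage_word n C D w'" "insertable n C c r\<^sub>0 A w'"
    "w = insert_column c r\<^sub>0 A w'"
proof -
  let ?F = "follows (insert c D)"
  have sw': "distinct w" "set w \<subseteq> insert c D \<union> row_labels n C"
     "\<forall>d\<in>insert c D. d \<in> set w \<longleftrightarrow> - d \<notin> set w" "successively ?F w" "w \<noteq> [] \<longrightarrow> last w \<notin> insert c D"
    using sw by (auto simp: stage_word_def)
  have cpos: "0 < c" using col_bounds[OF c] by simp
  obtain p r\<^sub>0 v where w: "w = p @ (if r\<^sub>0 = - c then [] else [c]) @ r\<^sub>0 # v"
    and r0: "- c \<le> r\<^sub>0" "r\<^sub>0 < c"
  proof (cases "c \<in> set w")
    case True
    then obtain p t where pt: "w = p @ c # t" by (meson split_list)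
    then have "t \<noteq> []" using sw'(5) by auto
    then obtain r\<^sub>0 v where t: "t = r\<^sub>0 # v" by (cases t) auto
    then have "?F c r\<^sub>0" using sw'(4) pt by (simp add: successively_append_iff)
    then show thesis using that[of p r\<^sub>0 v] pt t by (auto simp: follows_def)
  next
    case False
    then have "- c \<in> set w" using sw'(3) by auto
    then obtain p v where "w = p @ - c # v" by (meson split_list)
    then show thesis using that[of p "- c" v] cpos by auto
  qed
  let ?Q = "\<lambda>x. r\<^sub>0 < x \<and> x < c"
  define s where "s = rev (takeWhile ?Q (rev p))"
  define u where "u = rev (dropWhile ?Q (rev p))"
  have p: "p = u @ s"
    unfolding s_def u_def by (metis rev_append rev_rev_ident takeWhile_dropWhile_id)
  have s: "\<forall>x\<in>set s. ?Q x" unfolding s_def by (auto dest: set_takeWhileD)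
  have u: "\<not> ?Q (last u)" if "u \<noteq> []"
    using that hd_dropWhile[of ?Q "rev p"] unfolding u_def by (simp add: last_rev)
  \<comment> \<open>Such letters have modulus below \<open>c\<close>, so among them
    \<open>follows\<close> is just \<open><\<close>. Hence \<open>s\<close> is increasing and is the
    sorted list of its own set.\<close>
  have low: "x \<notin> insert c D" "- x \<notin> insert c D" if "?Q x" for x
    using that r0 D by force+
  have r0row: "r\<^sub>0 \<in> row_labels n C" "r\<^sub>0 \<notin> insert c D"
    using sw'(2) r0 D by (auto simp: w)
  have srow: "set s \<subseteq> row_labels n C"
    using sw'(2) low s by (auto simp: w p)
  have cw: "c \<notin> set u" "c \<notin> set v" "c \<notin> set s"
    using sw'(1) sw'(3) s by (auto simp: w p split: if_splits)
  have "successively ?F s" using sw'(4) by (simp add: w p successively_append_iff)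
  then have "successively (<) s"
  proof (rule successively_mono)
    fix x y assume "x \<in> set s" "y \<in> set s" "?F x y"
    then show "x < y" using low[of x] low[of y] s by (simp add: follows_def)
  qed
  then have "sorted_wrt (<) s"
    by (subst (asm) successively_conv_sorted_wrt) (auto simp: transp_def)
  then have s_eq: "sorted_list_of_set (set s) = s"
    by (simp add: sorted_list_of_set.idem_if_sorted_distinct strict_sorted_iff)
  let ?w' = "u @ r\<^sub>0 # v"
  have r0u: "r\<^sub>0 \<notin> set u" using sw'(1) by (auto simp: w p)
  have w_eq: "w = insert_column c r\<^sub>0 (set s) ?w'"
    using r0u by (simp add: insert_column_def insert_before_split s_eq w p)
  have dist: "distinct ?w'" "set s \<inter> set ?w' = {}" using sw'(1) by (auto simp: w p)
  have "insertable n C c r\<^sub>0 (set s) ?w'"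
  proof -
    have "- c \<notin> set ?w'" if "r\<^sub>0 \<noteq> - c" using that sw'(3) by (auto simp: w p)
    then show ?thesis using r0 r0row srow s dist by (auto simp: insertable_def)
  qed
  moreover have "stage_word n C D ?w'"
  proof -
    have "set ?w' \<subseteq> D \<union> row_labels n C"
      using sw'(2) cw r0row by (auto simp: w p)
    moreover have "\<forall>d\<in>D. d \<in> set ?w' \<longleftrightarrow> - d \<notin> set ?w'"
    proof
      fix d assume d: "d \<in> D"
      then have "c < d" "d \<notin> set s" "- d \<notin> set s"
        using D s low(1)[of d] low(2)[of "- d"] by auto
      moreover have "d \<in> set w \<longleftrightarrow> - d \<notin> set w" using sw'(3) d by auto
      ultimately show "d \<in> set ?w' \<longleftrightarrow> - d \<notin> set ?w'" using cpos by (auto simp: w p split: if_splits)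
    qed
    moreover have "successively (follows D) ?w'"
    proof -
      \<comment> \<open>Dropping \<open>c\<close> from \<open>D\<close> matters only for
        \<open>c\<close> as first and \<open>- c\<close> as second letter of a pair. In
        \<open>?w'\<close> the letter \<open>c\<close> is gone, and \<open>- c\<close> can only be
        \<open>r\<^sub>0\<close>.\<close>
      have mono: "follows D x y" if "?F x y" "x \<noteq> c" "y \<noteq> - c" for x y
        using that by (auto simp: follows_def)
      have Fu: "successively ?F u" and Fv: "successively ?F (r\<^sub>0 # v)"
        using sw'(4) by (auto simp: w p successively_append_iff)
      have "- c \<notin> set u" "- c \<notin> set v"
        using sw'(1,3) by (auto simp: w p split: if_splits)
      note nc = this
      have "successively (follows D) u"
        using Fu by (rule successively_mono) (use mono nc cw in metis)
      moreover have "successively (follows D) (r\<^sub>0 # v)"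
      proof -
        have "successively ?F v" using Fv by (auto simp: successively_Cons)
        then have "successively (follows D) v"
          by (rule successively_mono) (use mono nc cw in metis)
        moreover have "follows D r\<^sub>0 (hd v)" if "v \<noteq> []"
        proof -
          have "hd v \<noteq> - c" using nc(2) hd_in_set[OF that] by metis
          then show ?thesis
            using Fv that mono[of r\<^sub>0 "hd v"] r0 by (auto simp: successively_Cons)
        qed
        ultimately show ?thesis by (auto simp: successively_Cons)
      qed
      moreover have "follows D (last u) r\<^sub>0" if ne: "u \<noteq> []"
      proof -
        \<comment> \<open>The letter that followed \<open>last u\<close> before the
          deletion.\<close>
        define y where "y = hd (s @ (if r\<^sub>0 = - c then [] else [c]) @ r\<^sub>0 # v)"
        have y: "y = - c \<and> r\<^sub>0 = - c \<or> r\<^sub>0 < y \<and> y \<le> c"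
          using s r0 unfolding y_def by (cases s) auto
        have F: "?F (last u) y"
          using sw'(4) ne unfolding y_def
          by (cases s; cases "r\<^sub>0 = - c") (auto simp: w p successively_append_iff)
        have nc: "last u \<noteq> c" "last u \<noteq> r\<^sub>0" using cw r0u ne last_in_set[OF ne] by auto
        show ?thesis
        proof (cases "last u \<in> D")
          case True
          then show ?thesis using F r0 D by (force simp: follows_def)
        next
          case False
          \<comment> \<open>Both alternatives of \<open>follows\<close> put \<open>last u\<close>
            below \<open>c\<close>; by maximality of the run it is then below
            \<open>r\<^sub>0\<close>.\<close>
          have "- y \<in> insert c D \<Longrightarrow> y = - c" using y r0 D by force
          then have "last u < c" using F False nc y cpos by (auto simp: follows_def)
          then show ?thesis using u[OF ne] nc False by (auto simp: follows_def)
        qed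
      qed
      ultimately show ?thesis by (auto simp: successively_append_iff)
    qed
    moreover have "last ?w' \<notin> D" using sw'(5) by (auto simp: w)
    ultimately show ?thesis using dist by (simp add: stage_word_def)
  qed
  ultimately show thesis using that w_eq by blast
qed

end

section \<open>Words of arrow data\<close>

text \<open>Smaller column labels are further right, so a topmost 1 lies to the right of all
  restricted 0s of its row. If it is not diagonal, the diagonal cell of its column holds a
  restricted 0 and is the last cell of Row \<open>- c\<close>. A non-diagonal restricted 0 lies
  below a topmost 1.\<close>

definition arrow_data :: "nat \<Rightarrow> int set \<Rightarrow> (int \<Rightarrow> int) \<Rightarrow> (int \<Rightarrow> int) \<Rightarrow> bool" where
  "arrow_data n C U M \<longleftrightarrow>
     (\<forall>c\<in>C. (U c, c) \<in> cells n C \<and> c < M (U c) \<and> (U c \<noteq> - c \<longrightarrow> M (- c) = c)) \<and>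
     (\<forall>r\<in>row_labels n C. M r = int n + 1 \<or>
        (r, M r) \<in> cells n C \<and> (r = - M r \<or> U (M r) < r))"

definition left_rows :: "nat \<Rightarrow> int set \<Rightarrow> (int \<Rightarrow> int) \<Rightarrow> int \<Rightarrow> int set" where
  "left_rows n C M c = {r \<in> row_labels n C. M r = c \<and> r \<noteq> - c}"

text \<open>For \<open>D = C\<close> this is the value of \<open>Phi_B\<close>; smaller
  \<open>D\<close> give the stages used in inductions.\<close>

definition column_word ::
  "nat \<Rightarrow> int set \<Rightarrow> (int \<Rightarrow> int) \<Rightarrow> (int \<Rightarrow> int) \<Rightarrow> int set \<Rightarrow> int list" where
  "column_word n C U M D = foldr (\<lambda>c. insert_column c (U c) (left_rows n C M c))
     (sorted_list_of_set D) (sorted_list_of_set {r \<in> row_labels n C. M r = int n + 1})"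

definition up_closed :: "int set \<Rightarrow> int set \<Rightarrow> bool" where
  "up_closed C D \<longleftrightarrow> D \<subseteq> C \<and> (\<forall>x\<in>C. \<forall>d\<in>D. d \<le> x \<longrightarrow> x \<in> D)"

lemma up_closed_insertD:
  assumes "up_closed C (insert c D)" "\<forall>d\<in>D. c < d"
  shows "up_closed C D" "c \<in> C" "D \<subseteq> C" "\<And>x. x \<in> C \<Longrightarrow> c < x \<Longrightarrow> x \<in> D"
proof -
  show "\<And>x. x \<in> C \<Longrightarrow> c < x \<Longrightarrow> x \<in> D" "c \<in> C" "D \<subseteq> C"
    using assms unfolding up_closed_def by fastforce+
  then show "up_closed C D" using assms(2) unfolding up_closed_def by force
qed

lemma sorted_list_of_set_insert_min:
  fixes c :: int
  assumes "finite D" "\<forall>d\<in>D. c < d"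
  shows "sorted_list_of_set (insert c D) = c # sorted_list_of_set D"
proof -
  have "c \<notin> D" using assms by auto
  then show ?thesis using assms by (simp add: insort_is_Cons less_imp_le)
qed

text \<open>\<open>foldr\<close> applies the head of the list last, so a new minimum is the column
  processed last. This is why the inductions on \<open>D\<close> add minima.\<close>

lemma column_word_insert:
  assumes "finite D" "\<forall>d\<in>D. c < d"
  shows "column_word n C U M (insert c D) =
    insert_column c (U c) (left_rows n C M c) (column_word n C U M D)"
  unfolding column_word_def sorted_list_of_set_insert_min[OF assms] by simp

lemma column_word_cong:
  assumes "finite D" "\<And>d. d \<in> D \<Longrightarrow> U d = U' d \<and> left_rows n C M d = left_rows n C M' d"
    and "\<And>r. r \<in> row_labels n C \<Longrightarrow> M r = int n + 1 \<longleftrightarrow> M' r = int n + 1"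
  shows "column_word n C U M D = column_word n C U' M' D"
proof -
  have "{r \<in> row_labels n C. M r = int n + 1} = {r \<in> row_labels n C. M' r = int n + 1}"
    using assms(3) by auto
  then show ?thesis
    unfolding column_word_def using assms(1,2) by (intro foldr_cong) auto
qed

section \<open>The word of arrow data: its stages, its injectivity and its reconstruction\<close>

context column_labels
begin

text \<open>The point is that \<open>U c\<close> is already present: since
  \<open>c < M (U c)\<close>, its row is unrestricted or has its arrow in an earlier column, and
  that arrow is not diagonal because \<open>- M (U c) < - c \<le> U c\<close>.\<close>

lemma column_word_step:
  assumes ad: "arrow_data n C U M" and D: "D \<subseteq> C" "\<forall>d\<in>D. c < d" and c: "c \<in> C"
    and up: "\<And>x. x \<in> C \<Longrightarrow> c < x \<Longrightarrow> x \<in> D"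
    and set_w: "set w = {r \<in> row_labels n C. M r \<in> insert (int n + 1) D \<and> r \<noteq> - M r} \<union>
      {c \<in> D. U c \<noteq> - c}"
  shows "insertable n C c (U c) (left_rows n C M c) w"
proof -
  have U: "U c \<in> row_labels n C" "- c \<le> U c" "U c < c" "c < M (U c)" "U c \<noteq> - c \<Longrightarrow> M (- c) = c"
    using ad c by (auto simp: arrow_data_def cells_iff)
  have "M (U c) = int n + 1 \<or> M (U c) \<in> C"
    using ad U(1) by (auto simp: arrow_data_def cells_iff)
  then have "M (U c) \<in> insert (int n + 1) D" using up U(4) by auto
  moreover have "U c \<noteq> - M (U c)" using U by auto
  ultimately have "U c \<in> set w" using U(1) by (simp add: set_w)
  moreover have "U c < r \<and> r < c" if "r \<in> left_rows n C M c" for r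
    using ad that col_bounds[OF c] by (auto simp: arrow_data_def cells_iff left_rows_def)
  moreover have "left_rows n C M c \<inter> set w = {}"
    using D col_bounds[OF c] col_not_row by (auto simp: left_rows_def set_w)
  moreover have "- c \<notin> set w" if "U c \<noteq> - c"
    using U(5)[OF that] D col_bounds c by (force simp: set_w)
  ultimately show ?thesis using U by (auto simp: insertable_def left_rows_def)
qed

text \<open>The letter set is carried along because \<open>column_word_step\<close> needs it. A row
  enters at the start or with its left arrow; a row whose rightmost restricted 0 is diagonal never
  enters.\<close>

lemma stage_word_column_word:
  assumes ad: "arrow_data n C U M" and "finite D" and "up_closed C D"
  shows "stage_word n C D (column_word n C U M D) \<and>
    set (column_word n C U M D) =
      {r \<in> row_labels n C. M r \<in> insert (int n + 1) D \<and> r \<noteq> - M r} \<union> {c \<in> D. U c \<noteq> - c}"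
  using assms(2,3)
proof (induction D rule: finite_linorder_min_induct)
  case empty
  let ?R = "{r \<in> row_labels n C. M r = int n + 1}"
  have "successively (follows {}) (sorted_list_of_set ?R)"
  proof (rule successively_mono)
    show "successively (<) (sorted_list_of_set ?R)"
      by (intro successively_if_sorted_wrt) simp
  qed (simp add: follows_def)
  moreover have "{r \<in> row_labels n C. M r = int n + 1 \<and> r \<noteq> - M r} = ?R"
    using row_bounds by force
  ultimately show ?case by (auto simp: column_word_def stage_word_def)
next
  case (insert c D)
  note up = up_closed_insertD[OF insert.prems insert.hyps(2)]
  let ?w = "column_word n C U M D"
  have sw: "stage_word n C D ?w" and set_w: "set ?w =
      {r \<in> row_labels n C. M r \<in> insert (int n + 1) D \<and> r \<noteq> - M r} \<union> {c \<in> D. U c \<noteq> - c}"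
    using insert.IH up(1) by auto
  have ins: "insertable n C c (U c) (left_rows n C M c) ?w"
    using ad up(3) insert.hyps(2) up(2,4) set_w by (rule column_word_step)
  note word = stage_word_insert_column[OF sw ins up(2,3) insert.hyps(2)]
  show ?case
    using word unfolding column_word_insert[OF insert.hyps]
    by (auto simp: set_w left_rows_def)
qed

text \<open>The insertions are undone from the smallest column upwards, ending at the increasing
  word of unrestricted rows.\<close>

lemma column_word_inject:
  assumes ad: "arrow_data n C U\<^sub>1 M\<^sub>1" "arrow_data n C U\<^sub>2 M\<^sub>2"
    and "finite D" and "up_closed C D"
    and "column_word n C U\<^sub>1 M\<^sub>1 D = column_word n C U\<^sub>2 M\<^sub>2 D"
  shows "(\<forall>c\<in>D. U\<^sub>1 c = U\<^sub>2 c \<and> left_rows n C M\<^sub>1 c = left_rows n C M\<^sub>2 c) \<and>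
    {r \<in> row_labels n C. M\<^sub>1 r = int n + 1} = {r \<in> row_labels n C. M\<^sub>2 r = int n + 1}"
  using assms(3-5)
proof (induction D rule: finite_linorder_min_induct)
  case empty
  have "{r \<in> row_labels n C. M\<^sub>1 r = int n + 1} = {r \<in> row_labels n C. M\<^sub>2 r = int n + 1}"
    using empty.prems(2) sorted_list_of_set_inject[of "{r \<in> row_labels n C. M\<^sub>1 r = int n + 1}"
        "{r \<in> row_labels n C. M\<^sub>2 r = int n + 1}"]
    by (simp add: column_word_def)
  then show ?case by simp
next
  case (insert c D)
  note up = up_closed_insertD[OF insert.prems(1) insert.hyps(2)]
  note sw1 = stage_word_column_word[OF ad(1) insert.hyps(1) up(1)]
  note sw2 = stage_word_column_word[OF ad(2) insert.hyps(1) up(1)]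
  have "insertable n C c (U\<^sub>1 c) (left_rows n C M\<^sub>1 c) (column_word n C U\<^sub>1 M\<^sub>1 D)"
    using ad(1) up(3) insert.hyps(2) up(2,4) sw1[THEN conjunct2] by (rule column_word_step)
  moreover have "insertable n C c (U\<^sub>2 c) (left_rows n C M\<^sub>2 c) (column_word n C U\<^sub>2 M\<^sub>2 D)"
    using ad(2) up(3) insert.hyps(2) up(2,4) sw2[THEN conjunct2] by (rule column_word_step)
  ultimately have "U\<^sub>1 c = U\<^sub>2 c \<and> left_rows n C M\<^sub>1 c = left_rows n C M\<^sub>2 c \<and>
      column_word n C U\<^sub>1 M\<^sub>1 D = column_word n C U\<^sub>2 M\<^sub>2 D"
    using insert_column_inject[OF sw1[THEN conjunct1] _ sw2[THEN conjunct1] _ up(2,3) insert.hyps(2)]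
      insert.prems(2) unfolding column_word_insert[OF insert.hyps] by blast
  then show ?case using insert.IH up(1) by auto
qed

lemma arrow_data_unique:
  assumes ad: "arrow_data n C U\<^sub>1 M\<^sub>1" "arrow_data n C U\<^sub>2 M\<^sub>2"
    and "column_word n C U\<^sub>1 M\<^sub>1 C = column_word n C U\<^sub>2 M\<^sub>2 C"
  shows "\<forall>c\<in>C. U\<^sub>1 c = U\<^sub>2 c" "\<forall>r\<in>row_labels n C. M\<^sub>1 r = M\<^sub>2 r"
proof -
  have "up_closed C C" by (auto simp: up_closed_def)
  note inj = column_word_inject[OF ad finite_cols this assms(3)]
  then show "\<forall>c\<in>C. U\<^sub>1 c = U\<^sub>2 c" by simp
  show "\<forall>r\<in>row_labels n C. M\<^sub>1 r = M\<^sub>2 r"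
  proof
    fix r assume r: "r \<in> row_labels n C"
    have left: "M\<^sub>1 r = c \<longleftrightarrow> M\<^sub>2 r = c" if "c \<in> C" "r \<noteq> - c" for c
    proof -
      have "r \<in> left_rows n C M\<^sub>1 c \<longleftrightarrow> r \<in> left_rows n C M\<^sub>2 c" using inj that by simp
      then show ?thesis using r that by (simp add: left_rows_def)
    qed
    have "r \<in> {r \<in> row_labels n C. M\<^sub>1 r = int n + 1} \<longleftrightarrow>
        r \<in> {r \<in> row_labels n C. M\<^sub>2 r = int n + 1}"
      using inj by simp
    then have none: "M\<^sub>1 r = int n + 1 \<longleftrightarrow> M\<^sub>2 r = int n + 1" using r by simp
    have "M\<^sub>1 r = int n + 1 \<or> M\<^sub>1 r \<in> C" "M\<^sub>2 r = int n + 1 \<or> M\<^sub>2 r \<in> C"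
      using ad r by (auto simp: arrow_data_def cells_iff)
    \<comment> \<open>A restricted row without a left arrow has its rightmost restricted 0 on the
      diagonal, which forces the value \<open>- r\<close>.\<close>
    then show "M\<^sub>1 r = M\<^sub>2 r" using left none by (metis minus_minus)
  qed
qed

text \<open>Rows absent from the word get the provisional value \<open>M r = - r\<close>, which is
  neither \<open>int n + 1\<close> nor a non-diagonal column and so contributes no letter. It is
  overwritten when the row appears in an inserted block.\<close>

lemma column_word_exhaust:
  assumes "finite D" and "D \<subseteq> C" and "stage_word n C D w"
  shows "\<exists>U M. w = column_word n C U M D \<and>
    (\<forall>c\<in>D. (U c, c) \<in> cells n C \<and> c < M (U c) \<and> (U c \<noteq> - c \<longrightarrow> - c \<notin> set w)) \<and>
    (\<forall>r\<in>row_labels n C. if r \<in> set w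
       then M r = int n + 1 \<or> M r \<in> D \<and> - M r < r \<and> r < M r \<and> U (M r) < r else M r = - r)"
  using assms
proof (induction D arbitrary: w rule: finite_linorder_min_induct)
  case empty
  define M where "M r = (if r \<in> set w then int n + 1 else - r)" for r :: int
  have "{r \<in> row_labels n C. M r = int n + 1} = set w"
    using empty.prems row_bounds by (force simp: M_def stage_word_def)
  moreover have "sorted_wrt (<) w"
  proof -
    have "follows {} = (<)" by (auto simp: follows_def fun_eq_iff)
    then have "successively (<) w" using empty.prems by (simp add: stage_word_def)
    then show ?thesis by (subst (asm) successively_conv_sorted_wrt) (auto simp: transp_def)
  qed
  ultimately have "column_word n C U M {} = w" for U
    by (simp add: column_word_def sorted_list_of_set.idem_if_sorted_distinct strict_sorted_iff)
  then show ?case by - (rule exI[of _ id], rule exI[of _ M], auto simp: M_def[abs_def])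
next
  case (insert c D)
  have c: "c \<in> C" and D: "D \<subseteq> C" using insert.prems by auto
  obtain r\<^sub>0 A w' where sw': "stage_word n C D w'" and ins: "insertable n C c r\<^sub>0 A w'"
    and w: "w = insert_column c r\<^sub>0 A w'"
    using insert_column_exhaust[OF insert.prems(2) c D insert.hyps(2)] by blast
  obtain U' M' where w': "w' = column_word n C U' M' D"
    and U': "\<And>d. d \<in> D \<Longrightarrow> (U' d, d) \<in> cells n C \<and> d < M' (U' d) \<and> (U' d \<noteq> - d \<longrightarrow> - d \<notin> set w')"
    and M': "\<And>r. r \<in> row_labels n C \<Longrightarrow> if r \<in> set w'
       then M' r = int n + 1 \<or> M' r \<in> D \<and> - M' r < r \<and> r < M' r \<and> U' (M' r) < r else M' r = - r"
    using insert.IH[OF D sw'] by metis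
  have set_w: "set w = set w' \<union> A \<union> (if r\<^sub>0 = - c then {} else {c})"
    unfolding w by (rule stage_word_insert_column[OF sw' ins c D insert.hyps(2)])
  have ins': "r\<^sub>0 \<in> set w'" "r\<^sub>0 \<in> row_labels n C" "- c \<le> r\<^sub>0" "r\<^sub>0 < c" "A \<subseteq> row_labels n C"
    "\<forall>r\<in>A. r\<^sub>0 < r \<and> r < c" "A \<inter> set w' = {}" "r\<^sub>0 \<noteq> - c \<Longrightarrow> - c \<notin> set w'"
    using ins by (auto simp: insertable_def)
  have low: "c < d" "d \<noteq> c" if "d \<in> D" for d using that insert.hyps(2) by auto
  have cb: "1 \<le> c" "c \<le> int n" using col_bounds[OF c] by auto
  define U where "U = U'(c := r\<^sub>0)"
  \<comment> \<open>Exactly the rows of \<open>A\<close> lose their provisional value.\<close>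
  define M where "M r = (if r \<in> A then c else M' r)" for r
  have MA: "M' r = - r" if "r \<in> A" for r
  proof -
    have "r \<in> row_labels n C" "r \<notin> set w'" using that ins'(5,7) by auto
    then show ?thesis using M'[of r] by simp
  qed
  have "column_word n C U M D = column_word n C U' M' D"
  proof (rule column_word_cong)
    fix d assume d: "d \<in> D"
    have "M r = d \<longleftrightarrow> M' r = d" if "r \<noteq> - d" for r
      using that low[OF d] MA[of r] by (auto simp: M_def)
    then show "U d = U' d \<and> left_rows n C M d = left_rows n C M' d"
      using low[OF d] by (auto simp: U_def left_rows_def)
  next
    fix r assume "r \<in> row_labels n C"
    then show "M r = int n + 1 \<longleftrightarrow> M' r = int n + 1"
      using MA[of r] row_bounds[of r] cb by (auto simp: M_def)
  qed (use insert.hyps in simp)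
  moreover have "left_rows n C M c = A"
  proof -
    have "M' r \<noteq> c" if "r \<in> row_labels n C" "r \<noteq> - c" for r
      using M'[OF that(1)] that(2) low cb by (auto split: if_splits)
    then show ?thesis using ins'(5,6) ins'(3) by (force simp: left_rows_def M_def)
  qed
  ultimately have "w = column_word n C U M (insert c D)"
    unfolding column_word_insert[OF insert.hyps] w w' by (simp add: U_def)
  moreover have "(U d, d) \<in> cells n C \<and> d < M (U d) \<and> (U d \<noteq> - d \<longrightarrow> - d \<notin> set w)"
    if d: "d \<in> insert c D" for d
  proof (cases "d = c")
    case True
    have "r\<^sub>0 \<notin> A" using ins' by auto
    moreover have "c < M' r\<^sub>0" using M'[OF ins'(2)] ins'(1) low cb by auto
    moreover have "- c \<notin> set w" if "r\<^sub>0 \<noteq> - c"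
      using ins'(3,6,8) that cb by (force simp: set_w)
    ultimately show ?thesis
      using True ins' c by (auto simp: U_def M_def cells_iff)
  next
    case False
    then have "d \<in> D" using d by simp
    \<comment> \<open>Otherwise the provisional value would give \<open>d < - U' d \<le> c\<close>,
      against \<open>c < d\<close>.\<close>
    moreover have "U' d \<notin> A"
    proof
      assume "U' d \<in> A"
      then have "d < - U' d" "- c \<le> U' d"
        using U'[OF \<open>d \<in> D\<close>] MA[of "U' d"] ins'(3,6) by force+
      then show False using low[OF \<open>d \<in> D\<close>] by simp
    qed
    moreover have "- d \<notin> A" "- d \<noteq> c" using low[OF \<open>d \<in> D\<close>] ins'(3,6) cb by force+
    ultimately show ?thesis using U'[of d] False by (auto simp: U_def M_def set_w)
  qed
  moreover have "if r \<in> set w then M r = int n + 1 \<or>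
      M r \<in> insert c D \<and> - M r < r \<and> r < M r \<and> U (M r) < r else M r = - r"
    if r: "r \<in> row_labels n C" for r
  proof -
    have "r \<noteq> c" using r c col_not_row by auto
    moreover have "U d = U' d" if "d \<in> D" for d using low[OF that] by (simp add: U_def)
    ultimately show ?thesis
      using M'[OF r] ins'(3,6,7) by (force simp: M_def set_w U_def)
  qed
  ultimately show ?case by blast
qed

text \<open>As all positive rows occur in \<open>w\<close>, only negative labels are absent; for
  these the provisional \<open>- r\<close> names the diagonal cell.\<close>

lemma arrow_data_exhaust:
  assumes sw: "stage_word n C C w" and rows: "{1..int n} - C \<subseteq> set w"
  obtains U M where "arrow_data n C U M" "w = column_word n C U M C"
proof -
  obtain U M where w: "w = column_word n C U M C"
    and U: "\<And>c. c \<in> C \<Longrightarrow> (U c, c) \<in> cells n C \<and> c < M (U c) \<and> (U c \<noteq> - c \<longrightarrow> - c \<notin> set w)"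
    and M: "\<And>r. r \<in> row_labels n C \<Longrightarrow> if r \<in> set w
       then M r = int n + 1 \<or> M r \<in> C \<and> - M r < r \<and> r < M r \<and> U (M r) < r else M r = - r"
    using column_word_exhaust[OF finite_cols subset_refl sw] by metis
  have "M (- c) = c" if "c \<in> C" "U c \<noteq> - c" for c
    using M[OF uminus_col_row[OF that(1)]] U[OF that(1)] that(2) by simp
  moreover have "M r = int n + 1 \<or> (r, M r) \<in> cells n C \<and> (r = - M r \<or> U (M r) < r)"
    if r: "r \<in> row_labels n C" for r
  proof (cases "r \<in> set w")
    case True
    then show ?thesis using M[OF r] r by (auto simp: cells_iff)
  next
    case False
    then have "- r \<in> C" using r rows row_negD by (auto simp: row_labels_def)
    then show ?thesis using False M[OF r] r col_bounds by (force simp: cells_iff)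
  qed
  ultimately have "arrow_data n C U M" using U by (auto simp: arrow_data_def)
  then show thesis using w that by blast
qed

end

section \<open>Type B permutations\<close>

text \<open>The moduli of the letters give back the underlying permutation, and the negative letters
  the set \<open>S\<close>.\<close>

lemma type_B_perms_iff:
  "w \<in> type_B_perms n \<longleftrightarrow> distinct (map abs w) \<and> abs ` set w = {1..int n}"
proof
  assume "w \<in> type_B_perms n"
  then obtain p S where p: "p \<in> permutations_of_set {1..int n}"
    and w: "w = map (\<lambda>x. if x \<in> S then - x else x) p"
    by (auto simp: type_B_perms_def)
  have "map abs w = p"
    unfolding w using p by (auto simp: permutations_of_set_def intro!: map_idI)
  then show "distinct (map abs w) \<and> abs ` set w = {1..int n}"
    using p by (metis list.set_map permutations_of_setD)
next
  assume w: "distinct (map abs w) \<and> abs ` set w = {1..int n}"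
  define S where "S = {x \<in> {1..int n}. - x \<in> set w}"
  have "map (\<lambda>x. if x \<in> S then - x else x) (map abs w) = w"
    unfolding map_map
  proof (rule map_idI)
    fix y assume y: "y \<in> set w"
    then have "\<bar>y\<bar> \<in> {1..int n}" using w by blast
    moreover have "- y \<in> set w \<Longrightarrow> y = - y"
      using w y by (metis abs_minus_cancel distinct_map inj_onD)
    ultimately show "((\<lambda>x. if x \<in> S then - x else x) \<circ> abs) y = y"
      using y by (cases "y < 0") (auto simp: S_def)
  qed
  moreover have "map abs w \<in> permutations_of_set {1..int n}"
    using w by (auto simp: permutations_of_set_def)
  moreover have "S \<subseteq> {1..int n}" by (auto simp: S_def)
  ultimately show "w \<in> type_B_perms n"
    unfolding type_B_perms_def mem_Collect_eq by metis
qed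

section \<open>Reading the column labels off a signed permutation\<close>

definition columns_of_word :: "nat \<Rightarrow> int list \<Rightarrow> int set" where
  "columns_of_word n w =
     {x \<in> {1..int n}. - x \<in> set w \<or> (\<exists>u y v. w = u @ x # y # v \<and> \<bar>y\<bar> < x)}"

text \<open>If a letter \<open>x\<close> outside \<open>C\<close> is followed by a smaller
  \<open>y\<close>, then distinctness of moduli makes \<open>y\<close> negative with
  \<open>x < - y\<close>, and \<open>- y\<close> is in \<open>C\<close> because a negative letter
  reveals its column.\<close>

lemma stage_word_columns_of_word:
  assumes w: "w \<in> type_B_perms n" and C: "C = columns_of_word n w"
  shows "stage_word n C C w"
proof -
  have dist: "distinct (map abs w)" and set_w: "abs ` set w = {1..int n}"
    using w by (auto simp: type_B_perms_iff)
  have dw: "distinct w" using dist by (simp add: distinct_map)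
  have inj: "x = y" if "x \<in> set w" "y \<in> set w" "\<bar>x\<bar> = \<bar>y\<bar>" for x y
    using dist that by (meson distinct_map inj_onD)
  have bounds: "x \<noteq> 0" "\<bar>x\<bar> \<le> int n" if "x \<in> set w" for x
  proof -
    have "\<bar>x\<bar> \<in> {1..int n}" using set_w that by blast
    then show "x \<noteq> 0" "\<bar>x\<bar> \<le> int n" by auto
  qed
  have neg: "- x \<in> C" if "x \<in> set w" "x < 0" for x
    using that bounds[of x] by (auto simp: C columns_of_word_def)
  have Cpos: "1 \<le> c" "c \<le> int n" if "c \<in> C" for c using that by (auto simp: C columns_of_word_def)
  have split: "\<exists>u y v. w = u @ x # y # v \<and> \<bar>y\<bar> < x" if "x \<in> C" "x \<in> set w" for x
  proof -
    have "- x \<notin> set w" using inj[of x "- x"] that Cpos[of x] by auto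
    then show ?thesis using that by (auto simp: C columns_of_word_def)
  qed
  have "set w \<subseteq> C \<union> row_labels n C"
  proof
    fix x assume x: "x \<in> set w"
    then show "x \<in> C \<union> row_labels n C"
      using bounds[of x] neg[of x] by (cases "x < 0") (force simp: row_labels_def)+
  qed
  moreover have "c \<in> set w \<longleftrightarrow> - c \<notin> set w" if c: "c \<in> C" for c
  proof -
    have "c \<in> abs ` set w" using set_w Cpos[OF c] by simp
    then have "c \<in> set w \<or> - c \<in> set w" by (force simp: abs_if)
    then show ?thesis using inj[of c "- c"] Cpos[OF c] by auto
  qed
  moreover have "follows C x y" if wxy: "w = u @ x # y # v" for u x y v
  proof (cases "x \<in> C")
    case True
    have "x \<in> set w" using wxy by simp
    then obtain u' y' v' where w': "w = u' @ x # y' # v'" and "\<bar>y'\<bar> < x"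
      using split True by blast
    \<comment> \<open>\<open>x\<close> occurs only once, so the pair witnessing
      \<open>x \<in> C\<close> is the given pair.\<close>
    moreover have "y' = y"
    proof -
      have "x \<notin> set u" "x \<notin> set (y # v)" using dw unfolding wxy by auto
      moreover have "u @ x # y # v = u' @ x # y' # v'" using trans[OF wxy[symmetric] w'] .
      ultimately show ?thesis using append_Cons_eq_iff[of x u "y # v" u' "y' # v'"] by simp
    qed
    ultimately show ?thesis using True by (auto simp: follows_def)
  next
    case False
    have xy: "x \<in> set w" "y \<in> set w" "x \<noteq> y" using wxy dw by auto
    have "\<bar>x\<bar> \<noteq> \<bar>y\<bar>" using inj xy by blast
    moreover have "\<not> \<bar>y\<bar> < x"
      using False wxy bounds[OF xy(1)] by (auto simp: C columns_of_word_def)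
    ultimately show ?thesis
      using False neg[OF xy(2)] by (auto simp: follows_def)
  qed
  \<comment> \<open>A letter of \<open>C\<close> in \<open>w\<close> has a successor, so the last
    letter would occur twice.\<close>
  moreover have "last w \<notin> C" if ne: "w \<noteq> []"
  proof
    assume lastC: "last w \<in> C"
    then obtain u y v where uyv: "w = u @ last w # y # v" using split[OF lastC] last_in_set[OF ne] by blast
    define x where "x = last w"
    have wx: "w = u @ x # y # v" using uyv unfolding x_def .
    have "x = last (y # v)" unfolding x_def by (subst uyv) simp
    then have "x \<in> set (y # v)" by (metis last_in_set list.discI)
    then show False using dw wx by auto
  qed
  ultimately show ?thesis
    using dw unfolding stage_word_def successively_iff_split by blast
qed

text \<open>Outside \<open>C\<close>, \<open>follows\<close> never lets a letter of smaller modulus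
  come after a positive one; inside \<open>C\<close>, the condition on the last letter provides such
  a successor.\<close>

lemma (in column_labels) stage_word_type_B:
  assumes sw: "stage_word n C C w" and rows: "{1..int n} - C \<subseteq> set w"
  shows "w \<in> type_B_perms n" "columns_of_word n w = C"
proof -
  have dw: "distinct w" and sub: "set w \<subseteq> C \<union> row_labels n C"
    and sgn: "\<And>c. c \<in> C \<Longrightarrow> c \<in> set w \<longleftrightarrow> - c \<notin> set w"
    and fol: "\<And>u x y v. w = u @ x # y # v \<Longrightarrow> follows C x y"
    and last: "w \<noteq> [] \<Longrightarrow> last w \<notin> C"
    using sw unfolding stage_word_def successively_iff_split by blast+
  have neg: "- x \<in> C" if "x \<in> set w" "x < 0" for x
    using that sub col_bounds[of x] row_negD[of x] by auto
  have bounds: "x \<noteq> 0" "\<bar>x\<bar> \<le> int n" if "x \<in> set w" for x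
    using that sub col_bounds[of x] row_bounds[of x] by (auto simp: abs_le_iff)
  have inj: "x = y" if "x \<in> set w" "y \<in> set w" "\<bar>x\<bar> = \<bar>y\<bar>" for x y
    using that sgn[of x] sgn[of y] neg[of x] neg[of y] by (cases "x < 0"; cases "y < 0") auto
  have "abs ` set w = {1..int n}"
  proof
    show "abs ` set w \<subseteq> {1..int n}" using bounds by force
    show "{1..int n} \<subseteq> abs ` set w"
    proof
      fix x assume x: "x \<in> {1..int n}"
      then have "x \<in> set w \<or> - x \<in> set w" using rows sgn[of x] by auto
      then show "x \<in> abs ` set w" using x by (metis abs_minus_cancel abs_of_pos atLeastAtMost_iff
            image_eqI less_le_trans zero_less_one)
    qed
  qed
  moreover have "distinct (map abs w)" using dw inj by (auto simp: distinct_map inj_on_def)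
  ultimately show "w \<in> type_B_perms n" by (simp add: type_B_perms_iff)
  show "columns_of_word n w = C"
  proof (rule set_eqI)
    fix x
    show "x \<in> columns_of_word n w \<longleftrightarrow> x \<in> C"
    proof
      assume "x \<in> columns_of_word n w"
      then have x: "1 \<le> x" "- x \<in> set w \<or> (\<exists>u y v. w = u @ x # y # v \<and> \<bar>y\<bar> < x)"
        by (auto simp: columns_of_word_def)
      from x(2) show "x \<in> C"
      proof
        assume "- x \<in> set w"
        then show ?thesis using neg[of "- x"] x(1) by simp
      next
        assume "\<exists>u y v. w = u @ x # y # v \<and> \<bar>y\<bar> < x"
        then obtain u y v where "w = u @ x # y # v" "\<bar>y\<bar> < x" by blast
        then show ?thesis using fol[of u x y v] by (auto simp: follows_def split: if_splits)
      qed
    next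
      assume x: "x \<in> C"
      have "\<exists>u y v. w = u @ x # y # v \<and> \<bar>y\<bar> < x" if "- x \<notin> set w"
      proof -
        have "x \<in> set w" using that sgn[OF x] by simp
        then obtain u t where w: "w = u @ x # t" by (meson split_list)
        then have "t \<noteq> []" using last x by auto
        then obtain y v where "t = y # v" by (cases t) auto
        then show ?thesis using fol[of u x y v] w x by (fastforce simp: follows_def)
      qed
      then show "x \<in> columns_of_word n w"
        using col_bounds[OF x] by (auto simp: columns_of_word_def)
    qed
  qed
qed

section \<open>Tableaux\<close>

definition top_one :: "filled_diagram \<Rightarrow> int \<Rightarrow> int" where
  "top_one T c = Min {r. (r, c) \<in> ones T}"

text \<open>The rightmost column has the least label; \<open>int n + 1\<close> exceeds all labels
  and marks unrestricted rows.\<close>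

definition restricted_col :: "nat \<Rightarrow> filled_diagram \<Rightarrow> int \<Rightarrow> int" where
  "restricted_col n T r = Min (insert (int n + 1) {c. (r, c) \<in> restricted_zeros n T})"

definition arrow_filling :: "nat \<Rightarrow> int set \<Rightarrow> (int \<Rightarrow> int) \<Rightarrow> (int \<Rightarrow> int) \<Rightarrow> filled_diagram" where
  "arrow_filling n C U M = Filled_Diagram C {(r, c) \<in> cells n C. U c \<le> r \<and> c < M r}"

context column_labels
begin

lemma finite_cell_row: "finite {c. (r, c) \<in> cells n C \<and> P c}"
  by (rule finite_subset[of _ C]) (auto simp: cells_iff)

lemma finite_cell_col: "finite {r. (r, c) \<in> cells n C \<and> P r}"
  by (rule finite_subset[of _ "row_labels n C"]) (auto simp: cells_iff)

lemma restricted_col_eqI: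
  assumes T: "cols T = C"
    and "\<And>c. (r, c) \<in> restricted_zeros n T \<Longrightarrow> m \<le> c"
    and "(r, m) \<in> restricted_zeros n T \<or> m = int n + 1"
  shows "restricted_col n T r = m"
proof -
  have cells: "(r, c) \<in> cells n C" if "(r, c) \<in> restricted_zeros n T" for c
    using that T by (auto simp: restricted_zeros_def zeros_def)
  have fin: "finite {c. (r, c) \<in> restricted_zeros n T}"
    by (rule finite_subset[OF _ finite_cols]) (use cells cells_iff in blast)
  have "m \<le> int n + 1"
    using assms(3) cells[of m] col_bounds[of m] by (auto simp: cells_iff)
  then show ?thesis
    unfolding restricted_col_def using assms(2,3) fin by (intro Min_eqI) auto
qed

text \<open>Every 0 that is diagonal or has a 1 above it satisfies \<open>M r \<le> c\<close>, so
  all cells to its left are 0 as well. In the diagonal case a topmost 1 elsewhere forces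
  \<open>M (- c) = c\<close>.\<close>

lemma tableau_of_arrow_data:
  assumes ad: "arrow_data n C U M"
  shows "arrow_filling n C U M \<in> PT_B n"
    and "\<forall>c\<in>C. top_one (arrow_filling n C U M) c = U c"
    and "\<forall>r\<in>row_labels n C. restricted_col n (arrow_filling n C U M) r = M r"
proof -
  let ?T = "arrow_filling n C U M"
  have ones: "(r, c) \<in> ones ?T \<longleftrightarrow> (r, c) \<in> cells n C \<and> U c \<le> r \<and> c < M r" for r c
    by (simp add: arrow_filling_def)
  have cols: "cols ?T = C" by (simp add: arrow_filling_def)
  have U: "(U c, c) \<in> cells n C" "c < M (U c)" "U c \<noteq> - c \<Longrightarrow> M (- c) = c" if "c \<in> C" for c
    using ad that by (auto simp: arrow_data_def)
  have M: "M r = int n + 1 \<or> (r, M r) \<in> cells n C \<and> (r = - M r \<or> U (M r) < r)"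
    if "r \<in> row_labels n C" for r
    using ad that by (auto simp: arrow_data_def)
  have top: "(U c, c) \<in> ones ?T" if "c \<in> C" for c using U[OF that] by (simp add: ones)
  have above: "one_above ?T r c \<longleftrightarrow> U c < r" if "c \<in> C" for r c
    using top[OF that] by (auto simp: one_above_def ones)
  have zeros: "(r, c) \<in> zeros n ?T \<longleftrightarrow> (r, c) \<in> cells n C \<and> (r < U c \<or> M r \<le> c)" for r c
    by (auto simp: zeros_def cols ones)
  have diag: "M (- c) \<le> c" if "(- c, c) \<in> zeros n ?T" for c
    using that U(1,3)[of c] by (force simp: zeros cells_iff)
  have left: "\<not> one_left ?T r c" if "M r \<le> c" for r c
    using that by (auto simp: one_left_def ones)
  have rz: "(r, c) \<in> restricted_zeros n ?T \<longleftrightarrow>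
      (r, c) \<in> cells n C \<and> (r < U c \<or> M r \<le> c) \<and> (U c < r \<or> r = - c)" for r c
    using above by (auto simp: restricted_zeros_def zeros cells_iff)
  show "?T \<in> PT_B n"
    unfolding PT_B_def mem_Collect_eq cols
  proof (intro conjI ballI impI)
    show "C \<subseteq> {1..int n}" by (rule cols_bounded)
    show "ones ?T \<subseteq> cells n C" using ones by auto
    show "\<exists>r. (r, c) \<in> ones ?T" if "c \<in> C" for c using top[OF that] by blast
    show "\<not> one_left ?T (- c) c" if "c \<in> C" "(- c, c) \<in> zeros n ?T" for c
      using left diag that by blast
    show "case x of (r, c) \<Rightarrow> \<not> (one_above ?T r c \<and> one_left ?T r c)" if "x \<in> zeros n ?T" for x
    proof -
      obtain r c where x: "x = (r, c)" by fastforce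
      have "c \<in> C" using that x by (auto simp: zeros cells_iff)
      then show ?thesis using that left[of r c] above[of c r] by (auto simp: x zeros)
    qed
  qed
  show "\<forall>c\<in>C. top_one ?T c = U c"
  proof
    fix c assume c: "c \<in> C"
    have "finite {r. (r, c) \<in> ones ?T}" unfolding ones by (rule finite_cell_col)
    then show "top_one ?T c = U c"
      unfolding top_one_def using top[OF c] by (intro Min_eqI) (auto simp: ones)
  qed
  show "\<forall>r\<in>row_labels n C. restricted_col n ?T r = M r"
  proof
    fix r assume r: "r \<in> row_labels n C"
    show "restricted_col n ?T r = M r"
    proof (rule restricted_col_eqI[OF cols])
      show "(r, M r) \<in> restricted_zeros n ?T \<or> M r = int n + 1"
        using M[OF r] by (auto simp: rz)
      fix c assume c: "(r, c) \<in> restricted_zeros n ?T"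
      then have "c \<in> C" "- c \<le> U c" by (auto simp: rz cells_iff U(1)[unfolded cells_iff])
      \<comment> \<open>A restricted 0 above the topmost 1 must be diagonal, where
        \<open>M (- c) = c\<close>.\<close>
      then show "M r \<le> c" using c U(3)[of c] by (auto simp: rz)
    qed
  qed
qed

text \<open>Conditions (2) and (3) forbid a 1 to the left of a restricted 0, so the 1s of Row
  \<open>r\<close> lie in columns below \<open>M r\<close>. Conversely, a 0 below a topmost 1 is
  restricted, hence not in such a column.\<close>

lemma tableau_arrow_data:
  assumes T: "T \<in> PT_B n" and cols: "cols T = C"
  defines "U \<equiv> top_one T" and "M \<equiv> restricted_col n T"
  shows "arrow_data n C U M" and "T = arrow_filling n C U M"
    and "Phi_B n T = column_word n C U M C"
proof -
  have sub: "ones T \<subseteq> cells n C" and ne: "\<And>c. c \<in> C \<Longrightarrow> \<exists>r. (r, c) \<in> ones T"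
    and no_left: "\<And>r c. (r, c) \<in> zeros n T \<Longrightarrow> one_above T r c \<Longrightarrow> \<not> one_left T r c"
    and diag: "\<And>c. c \<in> C \<Longrightarrow> (- c, c) \<in> zeros n T \<Longrightarrow> \<not> one_left T (- c) c"
    using T unfolding PT_B_def mem_Collect_eq cols by auto
  have fin_ones: "finite {r. (r, c) \<in> ones T}" for c
    by (rule finite_subset[OF _ finite_rows]) (use sub cells_iff in blast)
  have top: "(U c, c) \<in> ones T" if "c \<in> C" for c
    using Min_in[OF fin_ones[of c]] ne[OF that] by (auto simp: U_def top_one_def)
  have top_le: "U c \<le> r" if "(r, c) \<in> ones T" for r c
    unfolding U_def top_one_def using that fin_ones by (intro Min_le) auto
  have above: "one_above T r c \<longleftrightarrow> U c < r" if "c \<in> C" for r c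
    using top[OF that] top_le[of _ c] by (fastforce simp: one_above_def)
  have zeros: "(r, c) \<in> zeros n T \<longleftrightarrow> (r, c) \<in> cells n C \<and> (r, c) \<notin> ones T" for r c
    by (auto simp: zeros_def cols)
  have rz: "(r, c) \<in> restricted_zeros n T \<longleftrightarrow>
      (r, c) \<in> cells n C \<and> (r, c) \<notin> ones T \<and> (U c < r \<or> r = - c)" for r c
    using above by (auto simp: restricted_zeros_def zeros cells_iff)
  have fin_rz: "finite {c. (r, c) \<in> restricted_zeros n T}" for r
    unfolding rz by (rule finite_cell_row)
  have M_in: "M r = int n + 1 \<or> (r, M r) \<in> restricted_zeros n T" for r
  proof -
    have "M r \<in> insert (int n + 1) {c. (r, c) \<in> restricted_zeros n T}"
      unfolding M_def restricted_col_def using fin_rz by (intro Min_in) auto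
    then show ?thesis by simp
  qed
  have M_le: "M r \<le> c" if "(r, c) \<in> restricted_zeros n T" for r c
    unfolding M_def restricted_col_def using that fin_rz by (intro Min_le) auto
  have right: "c < M r" if o: "(r, c) \<in> ones T" for r c
  proof (rule ccontr)
    assume "\<not> c < M r"
    moreover have c: "c \<in> C" using o sub by (auto simp: cells_iff)
    ultimately have m: "(r, M r) \<in> restricted_zeros n T" "M r \<le> c"
      using M_in[of r] col_bounds[of c] by auto
    then have mz: "M r \<in> C" "(r, M r) \<in> zeros n T" "(r, M r) \<notin> ones T" "U (M r) < r \<or> r = - M r"
      by (auto simp: rz zeros cells_iff)
    then have "M r < c" using m o by (metis order_less_le)
    then have "one_left T r (M r)" using o by (auto simp: one_left_def)
    then show False using mz no_left[of r "M r"] diag[of "M r"] above[of "M r" r] by metis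
  qed
  have diagM: "M (- c) = c" if "c \<in> C" "U c \<noteq> - c" for c
  proof -
    have "(U c, c) \<in> cells n C" using sub top[OF that(1)] by auto
    then have "(- c, c) \<notin> ones T" using top_le[of "- c" c] that by (auto simp: cells_iff)
    then have z: "(- c, c) \<in> restricted_zeros n T"
      using that uminus_col_row col_bounds[of c] by (auto simp: rz cells_iff)
    then have "M (- c) \<le> c" by (rule M_le)
    \<comment> \<open>Row \<open>- c\<close> ends at its diagonal cell, so no restricted 0 lies
      further right.\<close>
    moreover from this have "(- c, M (- c)) \<in> restricted_zeros n T"
      using M_in[of "- c"] col_bounds[OF that(1)] by auto
    ultimately show ?thesis by (auto simp: rz cells_iff)
  qed
  show ad: "arrow_data n C U M"
    unfolding arrow_data_def using sub top right diagM M_in by (force simp: rz)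
  have ones: "(r, c) \<in> ones T \<longleftrightarrow> (r, c) \<in> cells n C \<and> U c \<le> r \<and> c < M r" for r c
  proof
    assume "(r, c) \<in> ones T"
    then show "(r, c) \<in> cells n C \<and> U c \<le> r \<and> c < M r" using sub top_le right by auto
  next
    assume a: "(r, c) \<in> cells n C \<and> U c \<le> r \<and> c < M r"
    show "(r, c) \<in> ones T"
    proof (rule ccontr)
      assume no: "(r, c) \<notin> ones T"
      have "c \<in> C" using a by (simp add: cells_iff)
      then have "U c \<noteq> r" using top no by metis
      then have "(r, c) \<in> restricted_zeros n T" using a no by (auto simp: rz)
      then show False using M_le a by fastforce
    qed
  qed
  then have "ones T = {(r, c) \<in> cells n C. U c \<le> r \<and> c < M r}" by auto
  then show "T = arrow_filling n C U M"
    unfolding arrow_filling_def cols[symmetric] by (metis filled_diagram.collapse)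
  have up: "(r, c) \<in> up_arrows T \<longleftrightarrow> c \<in> C \<and> r = U c \<and> r \<noteq> - c" for r c
  proof (cases "c \<in> C")
    case True
    have "(r, c) \<in> up_arrows T \<longleftrightarrow> (r, c) \<in> ones T \<and> \<not> U c < r \<and> r \<noteq> - c"
      using above[OF True] by (simp add: up_arrows_def)
    also have "\<dots> \<longleftrightarrow> r = U c \<and> r \<noteq> - c"
      using top[OF True] top_le[of r c] by (metis order_le_less order_less_irrefl)
    finally show ?thesis using True by simp
  next
    case False
    then show ?thesis using sub by (auto simp: up_arrows_def cells_iff)
  qed
  have left: "{r. (r, c) \<in> left_arrows n T} = left_rows n C M c" if c: "c \<in> C" for c
  proof (rule set_eqI)
    fix r
    have "(r, c) \<in> left_arrows n T \<longleftrightarrow> (r, c) \<in> restricted_zeros n T \<and> M r = c \<and> r \<noteq> - c"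
    proof (cases "(r, c) \<in> restricted_zeros n T")
      case True
      then have "M r \<le> c" by (rule M_le)
      then have "(r, M r) \<in> restricted_zeros n T" using M_in[of r] col_bounds[OF c] by auto
      then have "(\<forall>c'<c. (r, c') \<notin> restricted_zeros n T) \<longleftrightarrow> M r = c"
        using \<open>M r \<le> c\<close> M_le[of r] by (metis order_le_less linorder_not_le)
      then show ?thesis using True by (simp add: left_arrows_def)
    qed (simp add: left_arrows_def)
    also have "\<dots> \<longleftrightarrow> r \<in> left_rows n C M c"
      using M_in[of r] col_bounds[OF c] by (auto simp: left_rows_def rz cells_iff)
    finally show "r \<in> {r. (r, c) \<in> left_arrows n T} \<longleftrightarrow> r \<in> left_rows n C M c" by simp
  qed
  have unres: "unrestricted_rows n T = {r \<in> row_labels n C. M r = int n + 1}"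
  proof -
    have "(\<forall>c. (r, c) \<notin> restricted_zeros n T) \<longleftrightarrow> M r = int n + 1" for r
      using M_in[of r] M_le[of r] col_bounds by (force simp: rz cells_iff)
    then show ?thesis by (simp add: unrestricted_rows_def cols)
  qed
  \<comment> \<open>Without an up arrow \<open>U c = - c\<close>, so both branches insert before
    \<open>U c\<close>. Merging the two insertions of the other branch requires \<open>c\<close> to
    be new.\<close>
  have proc: "process_column n T c w = insert_column c (U c) (left_rows n C M c) w"
    if "c \<in> C" "c \<notin> set w" for c w
  proof -
    have "U c \<noteq> c" using top[OF that(1)] sub by (auto simp: cells_iff)
    moreover have "(THE r. r = U c \<and> r \<noteq> - c) = U c" if "U c \<noteq> - c"
      using that by (intro the_equality) auto
    ultimately show ?thesis
      using that insert_before_append[of c w "U c"]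
      by (auto simp: process_column_def up left insert_column_def Let_def)
  qed
  \<comment> \<open>Induction over the stages supplies the freshness: a label smaller than all of
    \<open>D\<close> has not yet been inserted.\<close>
  have "foldr (process_column n T) (sorted_list_of_set D)
      (sorted_list_of_set (unrestricted_rows n T)) = column_word n C U M D"
    if "finite D" "up_closed C D" for D
    using that
  proof (induction D rule: finite_linorder_min_induct)
    case empty
    then show ?case by (simp add: column_word_def unres)
  next
    case (insert c D)
    note up = up_closed_insertD[OF insert.prems insert.hyps(2)]
    have "c \<notin> set (column_word n C U M D)"
      using stage_word_column_word[OF ad insert.hyps(1) up(1)] insert.hyps(2) col_not_row[OF up(2)]
      by auto
    then show ?case
      unfolding column_word_insert[OF insert.hyps] sorted_list_of_set_insert_min[OF insert.hyps]
      using insert.IH[OF up(1)] proc[OF up(2)] by simp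
  qed
  moreover have "up_closed C C" by (auto simp: up_closed_def)
  ultimately show "Phi_B n T = column_word n C U M C"
    by (simp add: Phi_B_def cols)
qed

text \<open>A positive row has no diagonal cell, so it is unrestricted or carries a left arrow and
  thus occurs in the word.\<close>

lemma column_word_type_B:
  assumes ad: "arrow_data n C U M"
  shows "column_word n C U M C \<in> type_B_perms n"
    and "columns_of_word n (column_word n C U M C) = C"
proof -
  have "up_closed C C" by (auto simp: up_closed_def)
  note word = stage_word_column_word[OF ad finite_cols this]
  have "{1..int n} - C \<subseteq> set (column_word n C U M C)"
  proof
    fix r assume r: "r \<in> {1..int n} - C"
    then have "r \<in> row_labels n C" by (simp add: row_labels_def)
    moreover from this have "M r \<in> insert (int n + 1) C"
      using ad by (auto simp: arrow_data_def cells_iff)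
    moreover from this have "r \<noteq> - M r" using r col_bounds[of "M r"] by auto
    ultimately show "r \<in> set (column_word n C U M C)" using word by simp
  qed
  then show "column_word n C U M C \<in> type_B_perms n"
    and "columns_of_word n (column_word n C U M C) = C"
    using stage_word_type_B word by blast+
qed

end

section \<open>Bijectivity of the map\<close>

theorem proposition4p1:
  fixes n :: nat
  assumes "n \<ge> 1"
  shows "bij_betw (Phi_B n) (PT_B n) (type_B_perms n)"
proof -
  have labels: "column_labels n (cols T)" if "T \<in> PT_B n" for T
    using that by (auto simp: column_labels_def PT_B_def)
  have cols: "columns_of_word n (Phi_B n T) = cols T" and perm: "Phi_B n T \<in> type_B_perms n"
    if T: "T \<in> PT_B n" for T
  proof -
    interpret column_labels n "cols T" using labels[OF T] .
    show "columns_of_word n (Phi_B n T) = cols T" "Phi_B n T \<in> type_B_perms n"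
      using tableau_arrow_data[OF T refl] column_word_type_B by simp_all
  qed
  have "T\<^sub>1 = T\<^sub>2" if T: "T\<^sub>1 \<in> PT_B n" "T\<^sub>2 \<in> PT_B n" and eq: "Phi_B n T\<^sub>1 = Phi_B n T\<^sub>2" for T\<^sub>1 T\<^sub>2
  proof -
    interpret column_labels n "cols T\<^sub>1" using labels[OF T(1)] .
    \<comment> \<open>The word determines the column labels, so both tableaux share one diagram and
      their arrow data become comparable.\<close>
    have c2: "cols T\<^sub>2 = cols T\<^sub>1" using cols[OF T(1)] cols[OF T(2)] eq by simp
    note 1 = tableau_arrow_data[OF T(1) refl] and 2 = tableau_arrow_data[OF T(2) c2]
    have "arrow_filling n (cols T\<^sub>1) (top_one T\<^sub>1) (restricted_col n T\<^sub>1) =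
        arrow_filling n (cols T\<^sub>1) (top_one T\<^sub>2) (restricted_col n T\<^sub>2)"
      using arrow_data_unique[OF 1(1) 2(1)] 1(3) 2(3) eq
      by (auto simp: arrow_filling_def cells_iff)
    then show ?thesis using 1(2) 2(2) by simp
  qed
  then have "inj_on (Phi_B n) (PT_B n)" by (auto simp: inj_on_def)
  moreover have "\<exists>T\<in>PT_B n. Phi_B n T = w" if w: "w \<in> type_B_perms n" for w
  proof -
    define C where "C = columns_of_word n w"
    interpret column_labels n C
      by unfold_locales (auto simp: C_def columns_of_word_def)
    have "{1..int n} - C \<subseteq> set w"
    proof
      fix x assume x: "x \<in> {1..int n} - C"
      then have "x \<in> abs ` set w" using w by (simp add: type_B_perms_iff)
      moreover have "- x \<notin> set w" using x by (auto simp: C_def columns_of_word_def)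
      ultimately show "x \<in> set w" by (auto simp: abs_if split: if_splits)
    qed
    then obtain U M where ad: "arrow_data n C U M" and wUM: "w = column_word n C U M C"
      using arrow_data_exhaust stage_word_columns_of_word[OF w C_def] by metis
    let ?T = "arrow_filling n C U M"
    note T = tableau_of_arrow_data[OF ad]
    have "cols ?T = C" by (simp add: arrow_filling_def)
    then have "Phi_B n ?T = column_word n C (top_one ?T) (restricted_col n ?T) C"
      using tableau_arrow_data(3)[OF T(1)] by simp
    \<comment> \<open>The data of \<open>?T\<close> agree with \<open>U\<close> and \<open>M\<close>
      on column and row labels, which is all the word depends on.\<close>
    also have "\<dots> = w"
      unfolding wUM using T(2,3) by (intro column_word_cong) (auto simp: left_rows_def)
    finally show ?thesis using T(1) by blast
  qed
  ultimately show ?thesis using perm by (auto simp: bij_betw_def)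
qed

end
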